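(* Let $n,m\ge 2$ be integers. If $n=3t+2$ and $m=3r+2$ for some nonnegative integers $t,r$, then $$b(P_n\boxtimes P_m)=2.$$
   Context: All graphs are finite, simple and undirected. $P_k$ denotes the path with $k$ vertices. The strong product $G\boxtimes H$ of graphs $G$ and $H$ has vertex set $V(G)\times V(H)$, and two vertices $(v,u)$ and $(v',u')$ are adjacent if and only if ($v=v'$ and $u\sim u'$), or ($v\sim v'$ and $u=u'$), or ($v\sim v'$ and $u\sim u'$), where $\sim$ denotes adjacency. A set $D$ of vertices of $G$ is dominating if every vertex of $G$ is in $D$ or adjacent to a vertex of $D$; the domination number $\gamma(G)$ is the minimum cardinality of a dominating set. For a graph $G$ with nonempty edge set $E$, the bondage number $b(G)$ is the minimum cardinality of a set $E'\subseteq E$ such that $\gamma(G-E')>\gamma(G)$, where $G-E'$ is obtained from $G$ by deleting the edges of $E'$ and keeping all vertices. *)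

theory Defs
  imports Main
begin

record 'a graph =
  verts :: "'a set"
  edges :: "'a set set"

definition simple_graph :: "'a graph \<Rightarrow> bool" where
  "simple_graph G \<longleftrightarrow>
     finite (verts G) \<and> (\<forall>e\<in>edges G. e \<subseteq> verts G \<and> card e = 2)"

definition adj :: "'a graph \<Rightarrow> 'a \<Rightarrow> 'a \<Rightarrow> bool" where
  "adj G u v \<longleftrightarrow> {u, v} \<in> edges G"

definition path_graph :: "nat \<Rightarrow> nat graph" where
  "path_graph k = \<lparr>verts = {..<k}, edges = {{i, Suc i} | i. Suc i < k}\<rparr>"

definition strong_product :: "'a graph \<Rightarrow> 'b graph \<Rightarrow> ('a \<times> 'b) graph" (infixl \<open>\<boxtimes>\<close> 70) where
  "G \<boxtimes> H =
     \<lparr>verts = verts G \<times> verts H,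
      edges = {{(v, u), (v', u')} | v u v' u'.
        v \<in> verts G \<and> v' \<in> verts G \<and> u \<in> verts H \<and> u' \<in> verts H \<and>
        ((v = v' \<and> adj H u u') \<or> (adj G v v' \<and> u = u') \<or> (adj G v v' \<and> adj H u u'))}\<rparr>"

definition delete_edges :: "'a graph \<Rightarrow> 'a set set \<Rightarrow> 'a graph" where
  "delete_edges G F = \<lparr>verts = verts G, edges = edges G - F\<rparr>"

definition dominating :: "'a graph \<Rightarrow> 'a set \<Rightarrow> bool" where
  "dominating G D \<longleftrightarrow> D \<subseteq> verts G \<and> (\<forall>v\<in>verts G. v \<in> D \<or> (\<exists>d\<in>D. adj G v d))"

definition domination_number :: "'a graph \<Rightarrow> nat" where
  "domination_number G = (LEAST k. \<exists>D. dominating G D \<and> card D = k)"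

text \<open>
  For a simple graph with at least one edge the set of candidates below is nonempty (delete all
  edges), so the minimum is attained. On edgeless graphs the value is meaningless.
\<close>

definition bondage_number :: "'a graph \<Rightarrow> nat" where
  "bondage_number G =
     (LEAST k. \<exists>F\<subseteq>edges G. card F = k \<and>
        domination_number (delete_edges G F) > domination_number G)"

lemma simple_graph_path_graph: "simple_graph (path_graph k)"
  by (auto simp: simple_graph_def path_graph_def)

lemma adj_commute: "adj G u v \<longleftrightarrow> adj G v u"
  by (simp add: adj_def insert_commute)

lemma simple_graph_adj_irrefl: "simple_graph G \<Longrightarrow> \<not> adj G v v"
  by (auto simp: simple_graph_def adj_def)

lemma simple_graph_strong_product:
  assumes "simple_graph G" "simple_graph H"
  shows "simple_graph (G \<boxtimes> H)"
proof -
  have "(v, u) \<noteq> (v', u')"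
    if "(v = v' \<and> adj H u u') \<or> (adj G v v' \<and> u = u') \<or> (adj G v v' \<and> adj H u u')"
    for v v' u u'
    using that simple_graph_adj_irrefl[OF assms(1)] simple_graph_adj_irrefl[OF assms(2)] by blast
  then have "card {(v, u), (v', u')} = 2"
    if "(v = v' \<and> adj H u u') \<or> (adj G v v' \<and> u = u') \<or> (adj G v v' \<and> adj H u u')"
    for v v' u u'
    using that by (metis card_2_iff)
  then show ?thesis
    using assms unfolding simple_graph_def strong_product_def by auto
qed

lemma adj_strong_product:
  assumes "v \<in> verts G" "v' \<in> verts G" "u \<in> verts H" "u' \<in> verts H"
  shows "adj (G \<boxtimes> H) (v, u) (v', u') \<longleftrightarrow>
    (v = v' \<and> adj H u u') \<or> (adj G v v' \<and> u = u') \<or> (adj G v v' \<and> adj H u u')"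
    (is "?L \<longleftrightarrow> ?R")
proof -
  have "?L \<longleftrightarrow> {(v, u), (v', u')} \<in> edges (G \<boxtimes> H)"
    by (simp only: adj_def)
  also have "\<dots> \<longleftrightarrow> ?R"
    unfolding strong_product_def using assms adj_commute[of G] adj_commute[of H]
    by (simp add: doubleton_eq_iff) blast
  finally show ?thesis .
qed

end

theory Submission
  imports Defs
begin

text \<open>
  Write \<open>n = 3t + 2\<close> and \<open>m = 3r + 2\<close>. The strong product of the two paths is the graph of king
  moves on an \<open>n \<times> m\<close> board, and its domination number is \<open>(t + 1)(r + 1)\<close>: cutting each
  coordinate into the blocks \<open>{3i, 3i + 1, 3i + 2}\<close>, the last one truncated to \<open>{3t, 3t + 1}\<close>,
  gives \<open>(t + 1)(r + 1)\<close> boxes, and the middle cell \<open>(3i + 1, 3j + 1)\<close> of a box can only be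
  dominated from within that box (\<open>dominating_meets_boxes\<close>).

  One edge is not enough, because the residue 2 leaves slack: the lattice of cells \<open>(3i, 3j)\<close> can
  be shifted by 0 or 1 in either coordinate and still dominates (\<open>dominating_shifted_lattice\<close>).
  The shifted lattices are disjoint, so among three of them one contains no end of the deleted edge
  and still dominates.

  Two edges suffice, because in the other direction there is no slack: a dominating set of size
  \<open>(t + 1)(r + 1)\<close> has exactly one cell in each box (\<open>inj_on_boxes\<close>). The closed neighbourhoods of
  the four cells in the corner \<open>{0, 1} \<times> {0, 1}\<close> all lie in the first box, so one cell \<open>d\<close> has to
  dominate these four, and \<open>d\<close> lies in the corner itself since it dominates \<open>(0, 0)\<close>. Deleting the
  two diagonals of the corner deprives \<open>d\<close> of its diagonal partner.
\<close>

section \<open>Domination and edge deletion\<close>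

lemma verts_delete_edges [simp]: "verts (delete_edges G F) = verts G"
  by (simp add: delete_edges_def)

lemma adj_delete_edges: "adj (delete_edges G F) u v \<longleftrightarrow> adj G u v \<and> {u, v} \<notin> F"
  by (simp add: adj_def delete_edges_def)

lemma dominating_delete_edgesD: "dominating (delete_edges G F) D \<Longrightarrow> dominating G D"
  by (auto simp: dominating_def adj_delete_edges)

lemma dominating_delete_edges_avoiding:
  assumes "dominating G D" and "\<And>e. e \<in> F \<Longrightarrow> e \<inter> D = {}"
  shows "dominating (delete_edges G F) D"
  using assms by (fastforce simp: dominating_def adj_delete_edges)

lemma domination_number_le: "dominating G D \<Longrightarrow> domination_number G \<le> card D"
  unfolding domination_number_def by (rule Least_le) blast

lemma domination_number_attained:
  obtains D where "dominating G D" and "card D = domination_number G"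
proof -
  have "\<exists>k D. dominating G D \<and> card D = k"
    using dominating_def by blast
  then have "\<exists>D. dominating G D \<and> card D = domination_number G"
    unfolding domination_number_def by (rule LeastI_ex)
  with that show ?thesis by blast
qed

text \<open>
  The two ends of an edge meet at most two of three disjoint sets, and a dominating set that
  contains neither end does not use the edge.
\<close>

lemma bondage_ge_2_of_disjoint_minimum_dominating_sets:
  assumes "simple_graph G" and "F \<subseteq> edges G"
    and increase: "domination_number G < domination_number (delete_edges G F)"
    and dom: "dominating G A" "dominating G B" "dominating G C"
    and min: "card A \<le> domination_number G" "card B \<le> domination_number G"
      "card C \<le> domination_number G"
    and disj: "A \<inter> B = {}" "A \<inter> C = {}" "B \<inter> C = {}"
  shows "2 \<le> card F"
proof (rule ccontr)
  assume "\<not> 2 \<le> card F"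
  have "finite (edges G)"
    using assms(1) finite_subset[of "edges G" "Pow (verts G)"] by (auto simp: simple_graph_def)
  then have "finite F"
    using assms(2) finite_subset by blast
  with \<open>\<not> 2 \<le> card F\<close> have "F = {} \<or> (\<exists>e. F = {e})"
    by (auto simp: not_le less_2_cases_iff card_1_singleton_iff)
  moreover have "\<exists>u v. e = {u, v}" if "e \<in> F" for e
    using assms(1,2) that by (metis card_2_iff simple_graph_def subsetD)
  ultimately obtain u v where "F \<subseteq> {{u, v}}"
    by blast
  moreover have "\<exists>D\<in>{A, B, C}. u \<notin> D \<and> v \<notin> D"
    using disj by (auto simp: disjoint_iff)
  then obtain D where "D \<in> {A, B, C}" "u \<notin> D" "v \<notin> D"
    by blast
  ultimately have "dominating (delete_edges G F) D"
    using dom by (intro dominating_delete_edges_avoiding) auto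
  then have "domination_number (delete_edges G F) \<le> card D"
    by (rule domination_number_le)
  with \<open>D \<in> {A, B, C}\<close> min increase show False
    by auto
qed

section \<open>King moves\<close>

lemma adj_path_graph:
  "adj (path_graph k) i j \<longleftrightarrow> i < k \<and> j < k \<and> (j = Suc i \<or> i = Suc j)"
  by (auto simp: adj_def path_graph_def doubleton_eq_iff)

lemma verts_strong_product_paths [simp]:
  "verts (path_graph n \<boxtimes> path_graph m) = {..<n} \<times> {..<m}"
  by (simp add: strong_product_def path_graph_def)

lemma closed_nbhd_strong_product_paths:
  assumes "x < n" "a < n" "y < m" "b < m"
  shows "(x, y) = (a, b) \<or> adj (path_graph n \<boxtimes> path_graph m) (x, y) (a, b) \<longleftrightarrow>
    x \<le> Suc a \<and> a \<le> Suc x \<and> y \<le> Suc b \<and> b \<le> Suc y"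
proof -
  have "x \<in> verts (path_graph n)" "a \<in> verts (path_graph n)"
    "y \<in> verts (path_graph m)" "b \<in> verts (path_graph m)"
    using assms by (simp_all add: path_graph_def)
  from adj_strong_product[OF this] show ?thesis
    using assms by (simp add: adj_path_graph) presburger
qed

lemma dominatingD_near:
  assumes "dominating (path_graph n \<boxtimes> path_graph m) D" and "x < n" "y < m"
  obtains a b where "(a, b) \<in> D" "x \<le> Suc a" "a \<le> Suc x" "y \<le> Suc b" "b \<le> Suc y"
proof -
  obtain d where d: "d \<in> D" "(x, y) = d \<or> adj (path_graph n \<boxtimes> path_graph m) (x, y) d"
    using assms unfolding dominating_def by fastforce
  obtain a b where ab: "d = (a, b)" by (cases d)
  have "a < n" "b < m"
    using assms(1) d(1) ab by (auto simp: dominating_def)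
  with d ab assms show ?thesis
    using that closed_nbhd_strong_product_paths[of x n a y m b] by blast
qed

lemma dominating_nearI:
  assumes "D \<subseteq> {..<n} \<times> {..<m}"
    and "\<And>x y. x < n \<Longrightarrow> y < m \<Longrightarrow>
      \<exists>a b. (a, b) \<in> D \<and> x \<le> Suc a \<and> a \<le> Suc x \<and> y \<le> Suc b \<and> b \<le> Suc y"
  shows "dominating (path_graph n \<boxtimes> path_graph m) D"
  unfolding dominating_def
proof (intro conjI ballI)
  fix p assume "p \<in> verts (path_graph n \<boxtimes> path_graph m)"
  then obtain x y where p: "p = (x, y)" "x < n" "y < m" by auto
  with assms(2) obtain a b where ab: "(a, b) \<in> D"
    "x \<le> Suc a \<and> a \<le> Suc x \<and> y \<le> Suc b \<and> b \<le> Suc y" by blast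
  moreover have "a < n" "b < m" using assms(1) ab by auto
  ultimately show "p \<in> D \<or> (\<exists>d\<in>D. adj (path_graph n \<boxtimes> path_graph m) p d)"
    using p closed_nbhd_strong_product_paths[of x n a y m b] by metis
qed (use assms(1) in simp)

section \<open>Minimum dominating sets when both orders are 2 modulo 3\<close>

definition box :: "nat \<times> nat \<Rightarrow> nat \<times> nat" where
  "box = (\<lambda>(x, y). (x div 3, y div 3))"

lemma dominating_meets_boxes:
  assumes "dominating (path_graph (3 * t + 2) \<boxtimes> path_graph (3 * r + 2)) D"
  shows "{..t} \<times> {..r} \<subseteq> box ` D"
proof clarify
  fix i j assume "i \<le> t" "j \<le> r"
  then have "3 * i + 1 < 3 * t + 2" "3 * j + 1 < 3 * r + 2" by auto
  with assms obtain a b where ab: "(a, b) \<in> D"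
    "3 * i + 1 \<le> Suc a" "a \<le> Suc (3 * i + 1)" "3 * j + 1 \<le> Suc b" "b \<le> Suc (3 * j + 1)"
    by (rule dominatingD_near)
  then have "a div 3 = i" "b div 3 = j" by linarith+
  with ab(1) show "(i, j) \<in> box ` D"
    by (force simp: box_def)
qed

lemma finite_dominating:
  "dominating (path_graph n \<boxtimes> path_graph m) D \<Longrightarrow> finite D"
  by (auto simp: dominating_def intro: finite_subset)

lemma card_dominating_ge:
  assumes "dominating (path_graph (3 * t + 2) \<boxtimes> path_graph (3 * r + 2)) D"
  shows "(t + 1) * (r + 1) \<le> card D"
proof -
  have "(t + 1) * (r + 1) = card ({..t} \<times> {..r})"
    by (simp add: card_cartesian_product)
  also have "\<dots> \<le> card D"
    using surj_card_le[OF finite_dominating[OF assms] dominating_meets_boxes[OF assms]] .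
  finally show ?thesis .
qed

lemma inj_on_boxes:
  assumes "dominating (path_graph (3 * t + 2) \<boxtimes> path_graph (3 * r + 2)) D"
    and "card D \<le> (t + 1) * (r + 1)"
  shows "inj_on box D"
proof (rule eq_card_imp_inj_on)
  show "finite D" using assms(1) by (rule finite_dominating)
  then have "card ({..t} \<times> {..r}) \<le> card (box ` D)"
    using dominating_meets_boxes[OF assms(1)] by (intro card_mono) auto
  then show "card (box ` D) = card D"
    using assms(2) card_image_le[OF \<open>finite D\<close>, of box] by (simp add: card_cartesian_product)
qed

definition shifted_lattice :: "nat \<Rightarrow> nat \<Rightarrow> nat \<Rightarrow> nat \<Rightarrow> (nat \<times> nat) set" where
  "shifted_lattice t r p q = (\<lambda>(i, j). (3 * i + p, 3 * j + q)) ` ({..t} \<times> {..r})"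

lemma card_shifted_lattice: "card (shifted_lattice t r p q) = (t + 1) * (r + 1)"
proof -
  have "inj_on (\<lambda>(i, j). (3 * i + p, 3 * j + q)) ({..t} \<times> {..r})"
    by (auto simp: inj_on_def)
  then show ?thesis
    by (simp add: shifted_lattice_def card_image card_cartesian_product)
qed

lemma shifted_lattices_disjoint:
  assumes "p < 3" "q < 3" "p' < 3" "q' < 3" and "(p, q) \<noteq> (p', q')"
  shows "shifted_lattice t r p q \<inter> shifted_lattice t r p' q' = {}"
proof -
  have "p = p' \<and> q = q'" if "3 * i + p = 3 * i' + p'" "3 * j + q = 3 * j' + q'" for i i' j j'
    using that assms(1-4) by presburger
  with assms(5) show ?thesis
    by (auto simp: shifted_lattice_def)
qed

lemma dominating_shifted_lattice:
  assumes "p \<le> 1" "q \<le> 1"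
  shows "dominating (path_graph (3 * t + 2) \<boxtimes> path_graph (3 * r + 2)) (shifted_lattice t r p q)"
proof (rule dominating_nearI)
  show "shifted_lattice t r p q \<subseteq> {..<3 * t + 2} \<times> {..<3 * r + 2}"
    using assms by (auto simp: shifted_lattice_def)
next
  fix x y assume "x < 3 * t + 2" "y < 3 * r + 2"
  \<comment> \<open>The lattice point \<open>3i + p\<close> dominates the numbers \<open>x\<close> with \<open>3i \<le> x + 1 - p \<le> 3i + 2\<close>.\<close>
  have near: "\<exists>i\<le>k. z \<le> Suc (3 * i + s) \<and> 3 * i + s \<le> Suc z" if "z < 3 * k + 2" "s \<le> 1" for z k s
    using that by (intro exI[of _ "(z + 1 - s) div 3"]) linarith
  obtain i where "i \<le> t" "x \<le> Suc (3 * i + p)" "3 * i + p \<le> Suc x"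
    using near[OF \<open>x < 3 * t + 2\<close> assms(1)] by blast
  moreover obtain j where "j \<le> r" "y \<le> Suc (3 * j + q)" "3 * j + q \<le> Suc y"
    using near[OF \<open>y < 3 * r + 2\<close> assms(2)] by blast
  ultimately show "\<exists>a b. (a, b) \<in> shifted_lattice t r p q \<and>
      x \<le> Suc a \<and> a \<le> Suc x \<and> y \<le> Suc b \<and> b \<le> Suc y"
    by (intro exI[of _ "3 * i + p"] exI[of _ "3 * j + q"])
      (auto simp: shifted_lattice_def image_iff)
qed

lemma domination_number_strong_product_paths:
  "domination_number (path_graph (3 * t + 2) \<boxtimes> path_graph (3 * r + 2)) = (t + 1) * (r + 1)"
proof (rule antisym)
  show "domination_number (path_graph (3 * t + 2) \<boxtimes> path_graph (3 * r + 2)) \<le> (t + 1) * (r + 1)"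
    using domination_number_le[OF dominating_shifted_lattice[of 0 0 t r]]
    by (simp add: card_shifted_lattice)
  show "(t + 1) * (r + 1) \<le> domination_number (path_graph (3 * t + 2) \<boxtimes> path_graph (3 * r + 2))"
    by (metis card_dominating_ge domination_number_attained)
qed

section \<open>Deleting the diagonals of a corner\<close>

definition corner_diagonals :: "(nat \<times> nat) set set" where
  "corner_diagonals = {{(0, 0), (1, 1)}, {(0, 1), (1, 0)}}"

lemma card_corner_diagonals: "card corner_diagonals = 2"
  by (auto simp: corner_diagonals_def doubleton_eq_iff card_2_iff)

lemma corner_diagonals_subset_edges:
  assumes "n \<ge> 2" "m \<ge> 2"
  shows "corner_diagonals \<subseteq> edges (path_graph n \<boxtimes> path_graph m)"
proof -
  have "adj (path_graph n \<boxtimes> path_graph m) (0, 0) (1, 1)"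
    "adj (path_graph n \<boxtimes> path_graph m) (0, 1) (1, 0)"
    using assms closed_nbhd_strong_product_paths[of 0 n 1 0 m 1]
      closed_nbhd_strong_product_paths[of 0 n 1 1 m 0] by auto
  then show ?thesis
    by (simp add: adj_def corner_diagonals_def)
qed

lemma domination_number_delete_corner_diagonals:
  defines "G \<equiv> \<lambda>t r. path_graph (3 * t + 2) \<boxtimes> path_graph (3 * r + 2)"
  shows "(t + 1) * (r + 1) < domination_number (delete_edges (G t r) corner_diagonals)"
proof (rule ccontr)
  assume small: "\<not> ?thesis"
  obtain D where D: "dominating (delete_edges (G t r) corner_diagonals) D"
    and "card D = domination_number (delete_edges (G t r) corner_diagonals)"
    by (rule domination_number_attained)
  with small have card: "card D \<le> (t + 1) * (r + 1)" by simp
  have DG: "dominating (path_graph (3 * t + 2) \<boxtimes> path_graph (3 * r + 2)) D"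
    using dominating_delete_edgesD[OF D] by (simp add: G_def)
  have inj: "inj_on box D"
    using inj_on_boxes[OF DG card] .
  obtain a b where ab: "(a, b) \<in> D" "a \<le> 1" "b \<le> 1"
    using dominatingD_near[OF DG, of 0 0] by auto
  \<comment> \<open>The diagonal partner of \<open>(a, b)\<close>; all its neighbours lie in the first box, as \<open>(a, b)\<close> does.\<close>
  let ?p = "(1 - a, 1 - b)"
  have "?p \<in> verts (G t r)"
    by (auto simp: G_def)
  with D obtain c d where cd: "(c, d) \<in> D"
    "?p = (c, d) \<or> adj (delete_edges (G t r) corner_diagonals) ?p (c, d)"
    unfolding dominating_def verts_delete_edges by fast
  then have "?p = (c, d) \<or> adj (G t r) ?p (c, d)"
    by (auto simp: adj_delete_edges)
  moreover have "c < 3 * t + 2" "d < 3 * r + 2"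
    using DG cd(1) by (auto simp: dominating_def)
  moreover have "1 - a < 3 * t + 2" "1 - b < 3 * r + 2"
    by simp_all
  ultimately have "c \<le> Suc (1 - a)" "d \<le> Suc (1 - b)"
    using closed_nbhd_strong_product_paths[of "1 - a" "3 * t + 2" c "1 - b" "3 * r + 2" d]
    by (simp_all add: G_def)
  then have "c \<le> 2" "d \<le> 2" by simp_all
  then have "box (c, d) = box (a, b)"
    using ab by (simp add: box_def)
  then have "(c, d) = (a, b)"
    using inj cd(1) ab(1) by (auto dest: inj_onD)
  moreover have "?p \<noteq> (a, b)" "{?p, (a, b)} \<in> corner_diagonals"
    using ab by (auto simp: corner_diagonals_def le_Suc_eq insert_commute)
  ultimately show False
    using cd(2) by (auto simp: adj_delete_edges)
qed

theorem theorem8: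
  fixes n m t r :: nat
  assumes "n \<ge> 2" and "m \<ge> 2"
    and "n = 3 * t + 2" and "m = 3 * r + 2"
  shows "bondage_number (path_graph n \<boxtimes> path_graph m) = 2"
proof -
  let ?G = "path_graph n \<boxtimes> path_graph m"
  have \<gamma>: "domination_number ?G = (t + 1) * (r + 1)"
    using domination_number_strong_product_paths assms(3,4) by simp
  show ?thesis
    unfolding bondage_number_def
  proof (rule Least_equality)
    show "\<exists>F\<subseteq>edges ?G. card F = 2 \<and> domination_number ?G < domination_number (delete_edges ?G F)"
      using corner_diagonals_subset_edges[OF assms(1,2)] card_corner_diagonals
        domination_number_delete_corner_diagonals[of t r] \<gamma> assms(3,4)
      by (intro exI[of _ corner_diagonals]) simp
  next
    fix k
    assume "\<exists>F\<subseteq>edges ?G. card F = k \<and> domination_number ?G < domination_number (delete_edges ?G F)"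
    then obtain F where F: "F \<subseteq> edges ?G" "card F = k"
      "domination_number ?G < domination_number (delete_edges ?G F)" by blast
    have "simple_graph ?G"
      by (intro simple_graph_strong_product simple_graph_path_graph)
    moreover have "dominating ?G (shifted_lattice t r p q)" if "p \<le> 1" "q \<le> 1" for p q
      using dominating_shifted_lattice that assms(3,4) by simp
    ultimately have "2 \<le> card F"
      using F(1,3)
      by (intro bondage_ge_2_of_disjoint_minimum_dominating_sets[of ?G F
            "shifted_lattice t r 0 0" "shifted_lattice t r 0 1" "shifted_lattice t r 1 0"]
          shifted_lattices_disjoint) (simp_all add: \<gamma> card_shifted_lattice)
    with F(2) show "2 \<le> k" by simp
  qed
qed

end
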